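(* Let $n>2$ be an integer, let $A\in\mathbb{R}^{n\times n}$ be a symmetric matrix with eigenvalues $0<\mu=\lambda_1\le\lambda_2\le\dots\le\lambda_n=L<\infty$, where $\mu<L$, and let $\gamma\ge\mu$. If the step size $\alpha$ satisfies $$0<\alpha\le\frac{\mu+\gamma+\sqrt{(\mu-\gamma)^2+4\gamma L}}{L-\mu},$$ then the NAG-GS method with constant step size $\alpha$ and constant scaling parameter $\gamma$, applied to the quadratic function $f(x)=\tfrac12x^\top Ax$ on $\mathbb{R}^n$, is convergent; that is, its iteration matrix $E(\alpha)\in\mathbb{R}^{2n\times 2n}$ satisfies $\rho(E(\alpha))<1$.
   Context: For a square matrix $B$, $\rho(B)$ denotes its spectral radius, i.e. the maximum modulus of its (complex) eigenvalues. Let $$G_{NAG}=\begin{bmatrix}-I_n & I_n\\ \frac1\gamma(\mu I_n-A) & -\frac{\mu}{\gamma}I_n\end{bmatrix},$$ and split $G_{NAG}=M+N$ (Gauss-Seidel splitting) with $$M=\begin{bmatrix}-I_n&0\\ \frac1\gamma(\mu I_n-A)&-\frac{\mu}{\gamma}I_n\end{bmatrix},\qquad N=\begin{bmatrix}0&I_n\\0&0\end{bmatrix}.$$ The NAG-GS method with constant step size $\alpha>0$, constant scaling parameter $\gamma>0$ and constant noise volatility $\sigma\geq 0$, applied to $f(x)=\tfrac12x^\top Ax$, generates $y_k=(x_k,v_k)\in\mathbb{R}^{2n}$ by $$\frac{x_{k+1}-x_k}{\alpha}=v_k-x_{k+1},\qquad \frac{v_{k+1}-v_k}{\alpha}=\frac{\mu}{\gamma}(x_{k+1}-v_{k+1})-\frac1\gamma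 Ax_{k+1}+\sigma\frac{W_{k+1}-W_k}{\alpha},$$ where $W_{k+1}-W_k=\sqrt{\alpha}\,\eta_k$ with $\eta_k$ independent standard Gaussian vectors in $\mathbb{R}^n$. Equivalently, $$y_{k+1}=E(\alpha)y_k+\begin{bmatrix}0\\ \frac{\sigma\sqrt\alpha}{1+\alpha\mu/\gamma}\eta_k\end{bmatrix},\qquad E(\alpha)=(I_{2n}-\alpha M)^{-1}(I_{2n}+\alpha N).$$ $E(\alpha)$ is called the iteration matrix. The method is called convergent (asymptotically convergent, or stable) for given $\alpha$ if $\rho(E(\alpha))<1$. *)

theory Defs
  imports "Jordan_Normal_Form.Spectral_Radius" "Jordan_Normal_Form.Gauss_Jordan_Elimination"
begin

definition nag_gs_M :: "nat \<Rightarrow> real \<Rightarrow> real \<Rightarrow> real mat \<Rightarrow> real mat" where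
  "nag_gs_M n \<mu> \<gamma> A =
     four_block_mat (- 1\<^sub>m n) (0\<^sub>m n n)
                    ((1 / \<gamma>) \<cdot>\<^sub>m (\<mu> \<cdot>\<^sub>m 1\<^sub>m n - A)) (- ((\<mu> / \<gamma>) \<cdot>\<^sub>m 1\<^sub>m n))"

definition nag_gs_N :: "nat \<Rightarrow> real mat" where
  "nag_gs_N n = four_block_mat (0\<^sub>m n n) (1\<^sub>m n) (0\<^sub>m n n) (0\<^sub>m n n)"

text \<open>
  \<^const>\<open>mat_inverse\<close> returns \<^const>\<open>None\<close> on singular matrices; the matrix inverted here is
  nonsingular for positive parameters, see \<open>nag_gs_inverse\<close> below.
\<close>

definition nag_gs_iteration_matrix :: "nat \<Rightarrow> real \<Rightarrow> real \<Rightarrow> real mat \<Rightarrow> real \<Rightarrow> real mat" where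
  "nag_gs_iteration_matrix n \<mu> \<gamma> A \<alpha> =
     the (mat_inverse (1\<^sub>m (2 * n) - \<alpha> \<cdot>\<^sub>m nag_gs_M n \<mu> \<gamma> A)) * (1\<^sub>m (2 * n) + \<alpha> \<cdot>\<^sub>m nag_gs_N n)"

definition nag_gs_convergent :: "nat \<Rightarrow> real \<Rightarrow> real \<Rightarrow> real mat \<Rightarrow> real \<Rightarrow> bool" where
  "nag_gs_convergent n \<mu> \<gamma> A \<alpha> \<longleftrightarrow>
     spectral_radius (map_mat complex_of_real (nag_gs_iteration_matrix n \<mu> \<gamma> A \<alpha>)) < 1"

text \<open>
  One step of the method, from \<open>(x, v)\<close> to \<open>(x', v')\<close>, where \<open>\<eta>\<close> is the realisation of the
  standard Gaussian vector, so that \<open>sqrt \<alpha> \<cdot>\<^sub>v \<eta>\<close> is the Brownian increment. The lemma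
  \<open>nag_gs_step_iff\<close> identifies its linear part with \<^const>\<open>nag_gs_iteration_matrix\<close>.
\<close>

definition nag_gs_step ::
  "real \<Rightarrow> real \<Rightarrow> real mat \<Rightarrow> real \<Rightarrow> real \<Rightarrow> real vec \<Rightarrow> real vec \<Rightarrow> real vec \<Rightarrow> real vec \<Rightarrow> real vec \<Rightarrow> bool"
  where
  "nag_gs_step \<mu> \<gamma> A \<alpha> \<sigma> \<eta> x v x' v' \<longleftrightarrow>
     (1 / \<alpha>) \<cdot>\<^sub>v (x' - x) = v - x' \<and>
     (1 / \<alpha>) \<cdot>\<^sub>v (v' - v) =
       (\<mu> / \<gamma>) \<cdot>\<^sub>v (x' - v') - (1 / \<gamma>) \<cdot>\<^sub>v (A *\<^sub>v x') + (\<sigma> / \<alpha>) \<cdot>\<^sub>v (sqrt \<alpha> \<cdot>\<^sub>v \<eta>)"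

lemma nag_gs_lhs_block:
  assumes "A \<in> carrier_mat n n"
  shows "1\<^sub>m (2 * n) - \<alpha> \<cdot>\<^sub>m nag_gs_M n \<mu> \<gamma> A =
     four_block_mat ((1 + \<alpha>) \<cdot>\<^sub>m 1\<^sub>m n) (0\<^sub>m n n)
       ((- \<alpha> / \<gamma>) \<cdot>\<^sub>m (\<mu> \<cdot>\<^sub>m 1\<^sub>m n - A)) ((1 + \<alpha> * \<mu> / \<gamma>) \<cdot>\<^sub>m 1\<^sub>m n)"
  using assms unfolding nag_gs_M_def by (intro eq_matI) auto

lemma nag_gs_rhs_block:
  "1\<^sub>m (2 * n) + \<alpha> \<cdot>\<^sub>m nag_gs_N n =
     four_block_mat (1\<^sub>m n) (\<alpha> \<cdot>\<^sub>m 1\<^sub>m n) (0\<^sub>m n n) (1\<^sub>m n)"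
  unfolding nag_gs_N_def by (intro eq_matI) auto

lemma nag_gs_inverse:
  fixes A :: "real mat"
  assumes A: "A \<in> carrier_mat n n" and pos: "\<mu> > 0" "\<gamma> > 0" "\<alpha> > 0"
  defines "P \<equiv> 1\<^sub>m (2 * n) - \<alpha> \<cdot>\<^sub>m nag_gs_M n \<mu> \<gamma> A"
  shows "P * the (mat_inverse P) = 1\<^sub>m (2 * n)"
    and "the (mat_inverse P) * P = 1\<^sub>m (2 * n)"
    and "the (mat_inverse P) \<in> carrier_mat (2 * n) (2 * n)"
    and "P \<in> carrier_mat (2 * n) (2 * n)"
proof -
  have P: "P \<in> carrier_mat (2 * n) (2 * n)"
    unfolding P_def nag_gs_M_def using A by auto
  have b: "1 + \<alpha> * \<mu> / \<gamma> > 0" using pos by (simp add: add_pos_pos)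
  have "det P = det ((1 + \<alpha>) \<cdot>\<^sub>m 1\<^sub>m n :: real mat) * det ((1 + \<alpha> * \<mu> / \<gamma>) \<cdot>\<^sub>m 1\<^sub>m n :: real mat)"
    unfolding P_def nag_gs_lhs_block[OF A]
    by (rule det_four_block_mat_upper_right_zero[of _ n _ n]) (use A in auto)
  also have "\<dots> = (1 + \<alpha>) ^ n * (1 + \<alpha> * \<mu> / \<gamma>) ^ n"
    by (simp add: det_smult)
  finally have "det P \<noteq> 0" using b pos by auto
  then have U: "P \<in> Units (ring_mat TYPE(real) (2 * n) ())"
    by (rule det_non_zero_imp_unit[OF P])
  then obtain Q where Q: "mat_inverse P = Some Q"
    using mat_inverse(1)[OF P, of "()"] by (cases "mat_inverse P") auto
  from mat_inverse(2)[OF P Q]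
  show "P * the (mat_inverse P) = 1\<^sub>m (2 * n)"
    "the (mat_inverse P) * P = 1\<^sub>m (2 * n)"
    "the (mat_inverse P) \<in> carrier_mat (2 * n) (2 * n)" by (simp_all add: Q)
  show "P \<in> carrier_mat (2 * n) (2 * n)" by (rule P)
qed

lemma smult_mat_mult_vec:
  fixes B :: "real mat"
  assumes "B \<in> carrier_mat m k" "u \<in> carrier_vec k"
  shows "(c \<cdot>\<^sub>m B) *\<^sub>v u = c \<cdot>\<^sub>v (B *\<^sub>v u)"
  using assms by (intro eq_vecI) auto

lemma nag_gs_step_iff:
  fixes A :: "real mat"
  assumes A: "A \<in> carrier_mat n n" and pos: "\<mu> > 0" "\<gamma> > 0" "\<alpha> > 0"
    and x: "x \<in> carrier_vec n" and v: "v \<in> carrier_vec n" and e: "\<eta> \<in> carrier_vec n"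
    and x': "x' \<in> carrier_vec n" and v': "v' \<in> carrier_vec n"
  shows "nag_gs_step \<mu> \<gamma> A \<alpha> \<sigma> \<eta> x v x' v' \<longleftrightarrow>
    x' @\<^sub>v v' = nag_gs_iteration_matrix n \<mu> \<gamma> A \<alpha> *\<^sub>v (x @\<^sub>v v)
      + (0\<^sub>v n @\<^sub>v (\<sigma> * sqrt \<alpha> / (1 + \<alpha> * \<mu> / \<gamma>)) \<cdot>\<^sub>v \<eta>)"
proof -
  define P where "P = 1\<^sub>m (2 * n) - \<alpha> \<cdot>\<^sub>m nag_gs_M n \<mu> \<gamma> A"
  define Q where "Q = the (mat_inverse P)"
  define R where "R = 1\<^sub>m (2 * n) + \<alpha> \<cdot>\<^sub>m nag_gs_N n"
  define y where "y = x @\<^sub>v v"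
  define y' where "y' = x' @\<^sub>v v'"
  define b where "b = 1 + \<alpha> * \<mu> / \<gamma>"
  define w where "w = 0\<^sub>v n @\<^sub>v (\<sigma> * sqrt \<alpha> / b) \<cdot>\<^sub>v \<eta>"
  define K where "K = (- \<alpha> / \<gamma>) \<cdot>\<^sub>m (\<mu> \<cdot>\<^sub>m 1\<^sub>m n - A)"
  have K: "K \<in> carrier_mat n n" unfolding K_def using A by (intro smult_carrier_mat minus_carrier_mat)
  have zero: "0\<^sub>m n n *\<^sub>v c = 0\<^sub>v n" if "c \<in> carrier_vec n" for c :: "real vec"
    using that by (intro eq_vecI) auto
  note inv = nag_gs_inverse[OF A pos, folded P_def, folded Q_def]
  have b: "b > 0" unfolding b_def using pos by (simp add: add_pos_pos)
  have y: "y \<in> carrier_vec (2 * n)" and y': "y' \<in> carrier_vec (2 * n)" and w: "w \<in> carrier_vec (2 * n)"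
    unfolding y_def y'_def w_def mult_2 using x v x' v' e by (simp_all only: append_carrier_vec zero_carrier_vec smult_carrier_vec)
  have R: "R \<in> carrier_mat (2 * n) (2 * n)" unfolding R_def nag_gs_N_def by auto
  have Pmul: "P *\<^sub>v (a @\<^sub>v c) = (1 + \<alpha>) \<cdot>\<^sub>v a @\<^sub>v (K *\<^sub>v a + b \<cdot>\<^sub>v c)"
    if a: "a \<in> carrier_vec n" and c: "c \<in> carrier_vec n" for a c
    unfolding P_def nag_gs_lhs_block[OF A] b_def[symmetric] K_def[symmetric]
    by (subst four_block_mat_mult_vec[of _ n n _ n _ n])
       (use K a c in \<open>simp_all add: zero smult_mat_mult_vec[of _ n n]\<close>)
  have Rmul: "R *\<^sub>v y = (x + \<alpha> \<cdot>\<^sub>v v) @\<^sub>v v"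
    unfolding R_def nag_gs_rhs_block y_def
    by (subst four_block_mat_mult_vec[of _ n n _ n _ n])
       (use x v in \<open>simp_all add: zero smult_mat_mult_vec[of _ n n]\<close>)
  have Pw: "P *\<^sub>v w = 0\<^sub>v n @\<^sub>v (\<sigma> * sqrt \<alpha>) \<cdot>\<^sub>v \<eta>"
  proof -
    have 0: "K *\<^sub>v 0\<^sub>v n = 0\<^sub>v n"
      using K by (intro eq_vecI) auto
    have 1: "(1 + \<alpha>) \<cdot>\<^sub>v 0\<^sub>v n = 0\<^sub>v n"
      by (intro eq_vecI) auto
    show ?thesis
      unfolding w_def using K e b by (subst Pmul) (simp_all add: 0 1 smult_smult_assoc)
  qed
  have C: "K *\<^sub>v x' = (- \<alpha> / \<gamma>) \<cdot>\<^sub>v (\<mu> \<cdot>\<^sub>v x' - A *\<^sub>v x')"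
  proof -
    have D: "\<mu> \<cdot>\<^sub>m 1\<^sub>m n - A \<in> carrier_mat n n" using A by (rule minus_carrier_mat)
    have "(\<mu> \<cdot>\<^sub>m 1\<^sub>m n - A) *\<^sub>v x' = \<mu> \<cdot>\<^sub>v x' - A *\<^sub>v x'"
      using A x' by (simp add: minus_mult_distrib_mat_vec[of _ n n] smult_mat_mult_vec[of _ n n])
    then show ?thesis
      unfolding K_def by (simp only: smult_mat_mult_vec[OF D x'])
  qed
  have "y' = (Q * R) *\<^sub>v y + w \<longleftrightarrow> P *\<^sub>v y' = R *\<^sub>v y + P *\<^sub>v w"
  proof
    assume "y' = (Q * R) *\<^sub>v y + w"
    then have "P *\<^sub>v y' = P *\<^sub>v (Q *\<^sub>v (R *\<^sub>v y)) + P *\<^sub>v w"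
      using inv R y w by (simp add: mult_add_distrib_mat_vec[of _ "2*n" "2*n"] assoc_mult_mat_vec[of _ "2*n" "2*n" _ "2*n"])
    also have "P *\<^sub>v (Q *\<^sub>v (R *\<^sub>v y)) = (P * Q) *\<^sub>v (R *\<^sub>v y)"
      using inv R y by (subst assoc_mult_mat_vec[of _ "2*n" "2*n" _ "2*n"]) auto
    finally show "P *\<^sub>v y' = R *\<^sub>v y + P *\<^sub>v w" using inv R y by simp
  next
    assume "P *\<^sub>v y' = R *\<^sub>v y + P *\<^sub>v w"
    then have "Q *\<^sub>v (P *\<^sub>v y') = Q *\<^sub>v (R *\<^sub>v y) + Q *\<^sub>v (P *\<^sub>v w)"
      using inv R y w by (simp add: mult_add_distrib_mat_vec[of _ "2*n" "2*n"])
    moreover have "Q *\<^sub>v (P *\<^sub>v z) = z" if "z \<in> carrier_vec (2 * n)" for z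
      using inv that by (subst assoc_mult_mat_vec[of _ "2*n" "2*n" _ "2*n", symmetric]) auto
    ultimately show "y' = (Q * R) *\<^sub>v y + w"
      using inv R y y' w by (simp add: assoc_mult_mat_vec[of _ "2*n" "2*n" _ "2*n"])
  qed
  also have "\<dots> \<longleftrightarrow> (1 + \<alpha>) \<cdot>\<^sub>v x' = x + \<alpha> \<cdot>\<^sub>v v \<and>
      (- \<alpha> / \<gamma>) \<cdot>\<^sub>v (\<mu> \<cdot>\<^sub>v x' - A *\<^sub>v x') + b \<cdot>\<^sub>v v' = v + (\<sigma> * sqrt \<alpha>) \<cdot>\<^sub>v \<eta>"
    unfolding Rmul Pw y'_def Pmul[OF x' v'] C using A x v x' v' e
    by (subst append_vec_add[of _ n _ _ n]) (auto simp: append_vec_eq[of _ n])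
  also have "\<dots> \<longleftrightarrow> nag_gs_step \<mu> \<gamma> A \<alpha> \<sigma> \<eta> x v x' v'"
  proof -
    have 1: "(1 + \<alpha>) * p' = p + \<alpha> * q \<longleftrightarrow> (1 / \<alpha>) * (p' - p) = q - p'" for p p' q :: real
      using pos by (auto simp: field_simps)
    have 2: "(- \<alpha> / \<gamma>) * (\<mu> * p' - c) + b * q' = q + \<sigma> * sqrt \<alpha> * t \<longleftrightarrow>
       (1 / \<alpha>) * (q' - q) = (\<mu> / \<gamma>) * (p' - q') - (1 / \<gamma>) * c + (\<sigma> / \<alpha>) * (sqrt \<alpha> * t)"
      (is "?a = ?c \<longleftrightarrow> ?a' = ?c'")
      for p' c q' q t :: real
    proof -
      have "?a - ?c = \<alpha> * (?a' - ?c')"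
        using pos by (simp add: field_simps b_def)
      then show ?thesis using pos by (metis eq_iff_diff_eq_0 mult_eq_0_iff less_irrefl)
    qed
    have "(1 + \<alpha>) \<cdot>\<^sub>v x' = x + \<alpha> \<cdot>\<^sub>v v \<longleftrightarrow> (1 / \<alpha>) \<cdot>\<^sub>v (x' - x) = v - x'"
      using x v x' 1 by (auto simp: vec_eq_iff)
    moreover have "(- \<alpha> / \<gamma>) \<cdot>\<^sub>v (\<mu> \<cdot>\<^sub>v x' - A *\<^sub>v x') + b \<cdot>\<^sub>v v' = v + (\<sigma> * sqrt \<alpha>) \<cdot>\<^sub>v \<eta> \<longleftrightarrow>
       (1 / \<alpha>) \<cdot>\<^sub>v (v' - v) =
       (\<mu> / \<gamma>) \<cdot>\<^sub>v (x' - v') - (1 / \<gamma>) \<cdot>\<^sub>v (A *\<^sub>v x') + (\<sigma> / \<alpha>) \<cdot>\<^sub>v (sqrt \<alpha> \<cdot>\<^sub>v \<eta>)"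
      (is "?l = ?r \<longleftrightarrow> ?l' = ?r'")
    proof -
      have "?l = ?r \<longleftrightarrow> (\<forall>i<n. ?l $ i = ?r $ i)"
        using A x' v v' e by (auto simp: vec_eq_iff)
      also have "\<dots> \<longleftrightarrow> (\<forall>i<n. ?l' $ i = ?r' $ i)"
      proof (intro all_cong)
        fix i assume "i < n"
        then show "?l $ i = ?r $ i \<longleftrightarrow> ?l' $ i = ?r' $ i"
          using 2[of "x' $ i" "(A *\<^sub>v x') $ i" "v' $ i" "v $ i" "\<eta> $ i"] A x' v v' e
          by (simp del: index_mult_mat_vec)
      qed
      also have "\<dots> \<longleftrightarrow> ?l' = ?r'"
        using A x' v v' e by (auto simp: vec_eq_iff)
      finally show ?thesis .
    qed
    ultimately show ?thesis unfolding nag_gs_step_def by blast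
  qed
  finally show ?thesis
    unfolding nag_gs_iteration_matrix_def y_def y'_def w_def P_def Q_def R_def b_def by blast
qed

end

theory Submission
  imports Defs
begin

text \<open>
  An eigenvector \<open>(x, v)\<close> of \<open>E(\<alpha>)\<close> for \<open>z \<noteq> 0\<close> satisfies \<open>(I + \<alpha> N) (x, v) = z (I - \<alpha> M) (x, v)\<close>.
  The first block expresses \<open>v\<close> as a multiple of \<open>x\<close>; substituting into the second block shows that
  \<open>x\<close> is an eigenvector of \<open>A\<close>, and that its eigenvalue \<open>\<lambda>\<close> is linked to \<open>z\<close> by a real quadratic
  equation. The Schur-Cohn criterion places \<open>z\<close> in the open unit disc as soon as
  \<open>\<alpha>\<^sup>2 (\<lambda> - \<mu>) < (2 + \<alpha>) (2 \<gamma> + \<alpha> \<mu>)\<close>, and the bound on \<open>\<alpha>\<close> is the positive root of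
  \<open>\<alpha>\<^sup>2 (L - \<mu>) = 2 (\<mu> + \<gamma>) \<alpha> + 4 \<gamma>\<close>.
\<close>

text \<open>Schur-Cohn criterion for a real quadratic: the polynomial is positive at 1 and -1, and
  its roots have product \<open>1 / a\<close> < 1.\<close>

lemma quadratic_root_norm_less_1:
  fixes z :: complex and a t :: real
  assumes root: "of_real a * z\<^sup>2 - of_real t * z + 1 = 0"
    and a: "1 < a" and t: "\<bar>t\<bar> < a + 1"
  shows "norm z < 1"
proof -
  have re: "a * ((Re z)\<^sup>2 - (Im z)\<^sup>2) - t * Re z + 1 = 0"
    using arg_cong[OF root, of Re] by (simp add: power2_eq_square)
  have im: "Im z * (2 * a * Re z - t) = 0"
    using arg_cong[OF root, of Im] by (simp add: power2_eq_square algebra_simps)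
  show ?thesis
  proof (cases "Im z = 0")
    case True
    define r where "r = \<bar>Re z\<bar>"
    have "a * r\<^sup>2 + 1 = t * Re z"
      using re True by (simp add: r_def)
    also have "\<dots> \<le> \<bar>t\<bar> * r"
      unfolding r_def by (metis abs_ge_self abs_mult)
    finally have le: "a * r\<^sup>2 + 1 \<le> \<bar>t\<bar> * r" .
    have "r < 1"
    \<comment> \<open>For \<open>r\<close> \<ge> 1 the bound on \<open>t\<close> gives
      \<open>(a * r - 1) * (r - 1) < 0\<close>, although both factors are nonnegative.\<close>
    proof (rule ccontr)
      assume "\<not> r < 1"
      then have "\<bar>t\<bar> * r < (a + 1) * r" and "0 \<le> (a * r - 1) * (r - 1)"
        using t a mult_mono[of 1 a 1 r] by auto
      then show False
        using le by (simp add: power2_eq_square algebra_simps)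
    qed
    then show ?thesis
      using True by (simp add: r_def cmod_eq_Re)
  next
    case False
    \<comment> \<open>The roots are conjugate, so their product \<open>1 / a\<close> is the squared modulus of each.\<close>
    with im have "t = 2 * a * Re z" by simp
    with re have "a * (norm z)\<^sup>2 = 1"
      unfolding cmod_power2 by (simp add: power2_eq_square algebra_simps)
    then have "(norm z)\<^sup>2 = 1 / a"
      using a by (simp add: field_simps)
    then have "(norm z)\<^sup>2 < 1\<^sup>2"
      using a by simp
    then show ?thesis
      by (rule power_less_imp_less_base) simp
  qed
qed

text \<open>The factorisation into real linear factors survives the embedding into the complex
  numbers, so a complex eigenvalue must be a root of one of these factors.\<close>

lemma eigenvalue_of_real_mat:
  fixes A :: "real mat" and lam :: "nat \<Rightarrow> real"
  assumes A: "A \<in> carrier_mat n n"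
    and char: "char_poly A = (\<Prod>i\<in>I. [:- lam i, 1:])"
    and k: "eigenvalue (map_mat complex_of_real A) k"
  shows "\<exists>i\<in>I. k = complex_of_real (lam i)"
proof -
  interpret p: map_poly_comm_ring_hom complex_of_real ..
  have "char_poly (map_mat complex_of_real A) = (\<Prod>i\<in>I. [:- complex_of_real (lam i), 1:])"
    unfolding of_real_hom.char_poly_hom[OF A] char p.hom_prod by simp
  moreover have "poly (char_poly (map_mat complex_of_real A)) k = 0"
    using k A by (subst eigenvalue_root_char_poly[symmetric]) auto
  ultimately have "(\<Prod>i\<in>I. k - complex_of_real (lam i)) = 0"
    by (simp add: poly_prod)
  then show ?thesis
    \<comment> \<open>For infinite \<open>I\<close> the product is 1 by convention and cannot
      vanish.\<close>
    by (cases "finite I") auto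
qed

text \<open>The relation says that the 2x2 determinant of \<open>R - z P\<close> vanishes once
  \<open>A\<close> acts as the scalar \<open>k\<close>.\<close>

lemma nag_gs_eigenvalue:
  fixes A :: "real mat"
  assumes A: "A \<in> carrier_mat n n" and pos: "\<mu> > 0" "\<gamma> > 0" "\<alpha> > 0"
    and ev: "eigenvalue (map_mat complex_of_real (nag_gs_iteration_matrix n \<mu> \<gamma> A \<alpha>)) z"
    and z: "z \<noteq> 0"
  shows "\<exists>k. eigenvalue (map_mat complex_of_real A) k \<and>
    (of_real (1 + \<alpha> * \<mu> / \<gamma>) * z - 1) * (of_real (1 + \<alpha>) * z - 1)
      = of_real (\<alpha>\<^sup>2 / \<gamma>) * z * (of_real \<mu> - k)"
proof -
  let ?c = complex_of_real
  define P where "P = 1\<^sub>m (2 * n) - \<alpha> \<cdot>\<^sub>m nag_gs_M n \<mu> \<gamma> A"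
  define R where "R = 1\<^sub>m (2 * n) + \<alpha> \<cdot>\<^sub>m nag_gs_N n"
  define E where "E = nag_gs_iteration_matrix n \<mu> \<gamma> A \<alpha>"
  define b where "b = 1 + \<alpha> * \<mu> / \<gamma>"
  define Ac where "Ac = map_mat ?c A"
  define Kc where "Kc = map_mat ?c ((- \<alpha> / \<gamma>) \<cdot>\<^sub>m (\<mu> \<cdot>\<^sub>m 1\<^sub>m n - A))"
  note inv = nag_gs_inverse[OF A pos, folded P_def]
  have R: "R \<in> carrier_mat (2 * n) (2 * n)"
    unfolding R_def nag_gs_N_def by auto
  have E: "E \<in> carrier_mat (2 * n) (2 * n)"
    unfolding E_def nag_gs_iteration_matrix_def P_def[symmetric] R_def[symmetric]
    using inv(3) R by (rule mult_carrier_mat)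
  \<comment> \<open>This removes the inverse from the eigenvector equation.\<close>
  have PE: "P * E = R"
    unfolding E_def nag_gs_iteration_matrix_def P_def[symmetric] R_def[symmetric]
    using inv R by (subst assoc_mult_mat[symmetric, of _ "2*n" "2*n" _ "2*n" _ "2*n"]) auto
  have Ac: "Ac \<in> carrier_mat n n" and Kc: "Kc \<in> carrier_mat n n"
    unfolding Ac_def Kc_def using A by auto
  obtain y where y: "y \<in> carrier_vec (2 * n)" and y0: "y \<noteq> 0\<^sub>v (2 * n)"
    and Ey: "map_mat ?c E *\<^sub>v y = z \<cdot>\<^sub>v y"
    using ev E unfolding eigenvalue_def eigenvector_def E_def[symmetric] by auto
  define x where "x = vec_first y n"
  define v where "v = vec_last y n"
  have yxv: "y = x @\<^sub>v v"
    unfolding x_def v_def using vec_first_last_append[of y n n] y by (simp add: mult_2)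
  have x: "x \<in> carrier_vec n" and v: "v \<in> carrier_vec n"
    unfolding x_def v_def by simp_all
  have "map_mat ?c R *\<^sub>v y = map_mat ?c P *\<^sub>v (map_mat ?c E *\<^sub>v y)"
    unfolding PE[symmetric] of_real_hom.mat_hom_mult[OF inv(4) E] using inv(4) E y
    by (subst assoc_mult_mat_vec[of _ "2*n" "2*n" _ "2*n"]) auto
  then have main: "map_mat ?c R *\<^sub>v (x @\<^sub>v v) = z \<cdot>\<^sub>v (map_mat ?c P *\<^sub>v (x @\<^sub>v v))"
    using inv(4) y by (simp add: Ey yxv[symmetric] mult_mat_vec[of _ "2*n" "2*n"])
  have Rc: "map_mat ?c R = four_block_mat (1\<^sub>m n) (?c \<alpha> \<cdot>\<^sub>m 1\<^sub>m n) (0\<^sub>m n n) (1\<^sub>m n)"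
    unfolding R_def nag_gs_rhs_block by (intro eq_matI) auto
  have Pc: "map_mat ?c P
      = four_block_mat (?c (1 + \<alpha>) \<cdot>\<^sub>m 1\<^sub>m n) (0\<^sub>m n n) Kc (?c b \<cdot>\<^sub>m 1\<^sub>m n)"
    unfolding P_def nag_gs_lhs_block[OF A] b_def[symmetric] Kc_def using A
    by (intro eq_matI) auto
  have zero: "0\<^sub>m n n *\<^sub>v u = 0\<^sub>v n" if "u \<in> carrier_vec n" for u :: "complex vec"
    using that by (intro eq_vecI) auto
  have one: "(k \<cdot>\<^sub>m 1\<^sub>m n) *\<^sub>v u = k \<cdot>\<^sub>v u" if "u \<in> carrier_vec n" for k and u :: "complex vec"
    using that by (intro eq_vecI) auto
  have Kx: "Kc *\<^sub>v x = ?c (- \<alpha> / \<gamma>) \<cdot>\<^sub>v (?c \<mu> \<cdot>\<^sub>v x - Ac *\<^sub>v x)"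
  proof -
    have "Kc = ?c (- \<alpha> / \<gamma>) \<cdot>\<^sub>m (?c \<mu> \<cdot>\<^sub>m 1\<^sub>m n - Ac)"
      unfolding Kc_def Ac_def using A by (intro eq_matI) auto
    also have "\<dots> *\<^sub>v x = ?c (- \<alpha> / \<gamma>) \<cdot>\<^sub>v ((?c \<mu> \<cdot>\<^sub>m 1\<^sub>m n - Ac) *\<^sub>v x)"
      using Ac x by (intro eq_vecI) auto
    also have "(?c \<mu> \<cdot>\<^sub>m 1\<^sub>m n - Ac) *\<^sub>v x = ?c \<mu> \<cdot>\<^sub>v x - Ac *\<^sub>v x"
      using Ac x by (simp add: minus_mult_distrib_mat_vec[of _ n n] one)
    finally show ?thesis .
  qed
  have "(x + ?c \<alpha> \<cdot>\<^sub>v v) @\<^sub>v v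
      = (z \<cdot>\<^sub>v (?c (1 + \<alpha>) \<cdot>\<^sub>v x)) @\<^sub>v (z \<cdot>\<^sub>v (Kc *\<^sub>v x + ?c b \<cdot>\<^sub>v v))"
  proof -
    have "map_mat ?c R *\<^sub>v (x @\<^sub>v v) = (x + ?c \<alpha> \<cdot>\<^sub>v v) @\<^sub>v v"
      unfolding Rc using x v
      by (subst four_block_mat_mult_vec[of _ n n _ n _ n]) (auto simp: zero one)
    moreover have "map_mat ?c P *\<^sub>v (x @\<^sub>v v) = (?c (1 + \<alpha>) \<cdot>\<^sub>v x) @\<^sub>v (Kc *\<^sub>v x + ?c b \<cdot>\<^sub>v v)"
      unfolding Pc using x v Kc
      by (subst four_block_mat_mult_vec[of _ n n _ n _ n]) (auto simp: zero one)
    moreover have "z \<cdot>\<^sub>v (p @\<^sub>v q) = (z \<cdot>\<^sub>v p) @\<^sub>v (z \<cdot>\<^sub>v q)" for p q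
      by (intro eq_vecI) auto
    ultimately show ?thesis using main by simp
  qed
  then have top: "x + ?c \<alpha> \<cdot>\<^sub>v v = z \<cdot>\<^sub>v (?c (1 + \<alpha>) \<cdot>\<^sub>v x)"
    and bot: "v = z \<cdot>\<^sub>v (Kc *\<^sub>v x + ?c b \<cdot>\<^sub>v v)"
    using x v by (simp_all add: append_vec_eq[of _ n])
  have topi: "?c \<alpha> * v $ i = (?c (1 + \<alpha>) * z - 1) * x $ i" if "i < n" for i
  proof -
    from arg_cong[OF top, of "\<lambda>u. u $ i"] that x v
    have "x $ i + ?c \<alpha> * v $ i = z * (?c (1 + \<alpha>) * x $ i)" by simp
    then show ?thesis by (simp add: algebra_simps)
  qed
  have boti: "v $ i = z * (?c (- \<alpha> / \<gamma>) * (?c \<mu> * x $ i - (Ac *\<^sub>v x) $ i) + ?c b * v $ i)"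
    if "i < n" for i
  proof -
    have "v $ i = (z \<cdot>\<^sub>v (Kc *\<^sub>v x + ?c b \<cdot>\<^sub>v v)) $ i"
      using bot by (rule arg_cong)
    also have "\<dots> = z * (?c (- \<alpha> / \<gamma>) * (?c \<mu> * x $ i - (Ac *\<^sub>v x) $ i) + ?c b * v $ i)"
      unfolding Kx using that x v Ac by (simp del: index_mult_mat_vec)
    finally show ?thesis .
  qed
  \<comment> \<open>If \<open>x\<close> vanished, the first block would force \<open>v\<close>, and
    hence \<open>y\<close>, to vanish.\<close>
  have x0: "x \<noteq> 0\<^sub>v n"
  proof
    assume x0: "x = 0\<^sub>v n"
    have "v $ i = 0" if "i < n" for i
      using topi[OF that] pos that by (simp add: x0)
    then have "v = 0\<^sub>v n"
      using v by (intro eq_vecI) simp_all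
    then have "y = 0\<^sub>v (2 * n)"
      unfolding yxv x0 by (intro eq_vecI) auto
    then show False
      using y0 by contradiction
  qed
  define q where "q = (?c b * z - 1) * (?c (1 + \<alpha>) * z - 1)"
  define s where "s = ?c (\<alpha>\<^sup>2 / \<gamma>) * z"
  have s0: "s \<noteq> 0" unfolding s_def using pos z by simp
  \<comment> \<open>The factor \<open>(1 + \<alpha>) z - 1\<close> turns \<open>x\<close> into
    \<open>\<alpha> v\<close> by the first block; the second block then eliminates
    \<open>v\<close>.\<close>
  have eq: "q * x $ i = s * (?c \<mu> * x $ i - (Ac *\<^sub>v x) $ i)" if "i < n" for i
  proof -
    let ?w = "?c \<mu> * x $ i - (Ac *\<^sub>v x) $ i"
    have "q * x $ i = (?c b * z - 1) * (?c \<alpha> * v $ i)"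
      by (simp only: q_def topi[OF that] mult.assoc)
    also have "\<dots> = ?c \<alpha> * (z * (?c b * v $ i) - v $ i)"
      by (simp add: algebra_simps)
    also have "z * (?c b * v $ i) - v $ i = z * (?c (\<alpha> / \<gamma>) * ?w)"
    proof -
      have "v $ i + z * (?c (\<alpha> / \<gamma>) * ?w) = z * (?c b * v $ i)"
        by (subst boti[OF that]) (simp add: ring_distribs)
      then show ?thesis
        by (metis add_diff_cancel_left')
    qed
    also have "?c \<alpha> * (z * (?c (\<alpha> / \<gamma>) * ?w)) = s * ?w"
      by (simp add: s_def power2_eq_square)
    finally show ?thesis .
  qed
  \<comment> \<open>Solves \<open>q = s * (\<mu> - k)\<close> for \<open>k\<close>; the division
    relies on \<open>z\<close> being nonzero.\<close>
  define k where "k = ?c \<mu> - q / s"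
  have "Ac *\<^sub>v x = k \<cdot>\<^sub>v x"
  proof (rule eq_vecI)
    fix i assume "i < dim_vec (k \<cdot>\<^sub>v x)"
    then have i: "i < n" using x by simp
    have "(Ac *\<^sub>v x) $ i = k * x $ i"
      using eq[OF i] s0 unfolding k_def by (simp add: field_simps)
    then show "(Ac *\<^sub>v x) $ i = (k \<cdot>\<^sub>v x) $ i"
      using i x by simp
  qed (use Ac x in simp)
  then have "eigenvalue Ac k"
    unfolding eigenvalue_def eigenvector_def using x x0 Ac by auto
  moreover have "q = s * (?c \<mu> - k)"
    using s0 by (simp add: k_def)
  ultimately show ?thesis
    unfolding q_def s_def b_def Ac_def by blast
qed

text \<open>Completing the square reduces the claim to \<open>(d x - h)^2\<close> \<le>
  \<open>h^2 + d g\<close>. The upper side is the assumed bound; the lower side follows from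
  \<open>x\<close> \<ge> 0, as \<open>h\<close> is at most the square root.\<close>

lemma le_larger_root_imp_quadratic_le:
  fixes d h g x :: real
  assumes d: "0 < d" and h: "0 \<le> h" and g: "0 \<le> g" and x: "0 \<le> x"
    and le: "x \<le> (h + sqrt (h\<^sup>2 + d * g)) / d"
  shows "d * x\<^sup>2 \<le> 2 * h * x + g"
proof -
  have "\<bar>d * x - h\<bar> \<le> sqrt (h\<^sup>2 + d * g)"
  proof (rule abs_leI)
    show "d * x - h \<le> sqrt (h\<^sup>2 + d * g)"
      using le d by (simp add: field_simps)
    have "h \<le> sqrt (h\<^sup>2 + d * g)"
      using d g by (intro real_le_rsqrt) simp
    then show "- (d * x - h) \<le> sqrt (h\<^sup>2 + d * g)"
      using mult_nonneg_nonneg[of d x] d x by linarith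
  qed
  then have "(d * x - h)\<^sup>2 \<le> h\<^sup>2 + d * g"
    by (metis abs_ge_zero d g h add_nonneg_nonneg less_imp_le mult_nonneg_nonneg power2_abs
        power_mono real_sqrt_pow2 zero_le_power2)
  then have "d * (d * x\<^sup>2) \<le> d * (2 * h * x + g)"
    by (simp add: power2_eq_square algebra_simps)
  then show ?thesis using d by simp
qed

theorem theorem1:
  fixes n :: nat and A :: "real mat" and lam :: "nat \<Rightarrow> real" and \<mu> L \<gamma> \<alpha> :: real
  assumes "n > 2"
    and "A \<in> carrier_mat n n"
    and "transpose_mat A = A"
    and "char_poly A = (\<Prod>i = 1..n. [:- lam i, 1:])"
    and "mono_on {1..n} lam"
    and "\<mu> = lam 1" and "L = lam n"
    and "0 < \<mu>" and "\<mu> < L"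
    and "\<gamma> \<ge> \<mu>"
    and "0 < \<alpha>"
    and "\<alpha> \<le> (\<mu> + \<gamma> + sqrt ((\<mu> - \<gamma>)\<^sup>2 + 4 * \<gamma> * L)) / (L - \<mu>)"
  shows "nag_gs_convergent n \<mu> \<gamma> A \<alpha>"
proof -
  let ?E = "map_mat complex_of_real (nag_gs_iteration_matrix n \<mu> \<gamma> A \<alpha>)"
  have pos: "\<mu> > 0" "\<gamma> > 0" "\<alpha> > 0" using assms by auto
  have "norm z < 1" if ev: "eigenvalue ?E z" for z
  proof (cases "z = 0")
    case False
    obtain k where k: "eigenvalue (map_mat complex_of_real A) k"
      and eq: "(of_real (1 + \<alpha> * \<mu> / \<gamma>) * z - 1) * (of_real (1 + \<alpha>) * z - 1)
        = of_real (\<alpha>\<^sup>2 / \<gamma>) * z * (of_real \<mu> - k)"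
      using nag_gs_eigenvalue[OF assms(2) pos ev False] by blast
    obtain i where i: "i \<in> {1..n}" and ki: "k = complex_of_real (lam i)"
      using eigenvalue_of_real_mat[OF assms(2,4) k] by blast
    define b where "b = 1 + \<alpha> * \<mu> / \<gamma>"
    define p where "p = \<alpha>\<^sup>2 / \<gamma>"
    \<comment> \<open>Expanding the eigenvalue relation gives leading coefficient
      \<open>b * (1 + \<alpha>)\<close>, constant term 1 and linear coefficient
      \<open>- t\<close>.\<close>
    define t where "t = b + (1 + \<alpha>) - p * (lam i - \<mu>)"
    have lam: "\<mu> \<le> lam i" "lam i \<le> L"
      using assms(1,6,7) i monotone_onD[OF assms(5)] by auto
    have b: "b > 1" unfolding b_def using pos by simp
    have "of_real (b * (1 + \<alpha>)) * z\<^sup>2 - of_real t * z + 1 = 0"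
      using eq unfolding b_def[symmetric] p_def[symmetric] ki t_def
      by (simp add: power2_eq_square algebra_simps)
    moreover have "1 < b * (1 + \<alpha>)"
      using b pos by (simp add: less_1_mult)
    moreover have "\<bar>t\<bar> < b * (1 + \<alpha>) + 1"
    proof (rule abs_leI[THEN le_less_trans])
      show "t \<le> max t (- t)" "- t \<le> max t (- t)" by simp_all
      \<comment> \<open>The gap \<open>b * (1 + \<alpha>) + 1 - t\<close> is the sum of these two
        terms.\<close>
      have "0 \<le> p * (lam i - \<mu>)" "0 < (b - 1) * \<alpha>"
        using pos lam b by (simp_all add: p_def)
      then have "t < b * (1 + \<alpha>) + 1"
        by (simp add: t_def algebra_simps)
      \<comment> \<open>Here the step size bound enters: the claim amounts to
        \<open>p * (lam i - \<mu>) < (2 + \<alpha>) * (b + 1)\<close>.\<close>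
      moreover have "- t < b * (1 + \<alpha>) + 1"
      proof -
        have "(L - \<mu>) * \<alpha>\<^sup>2 \<le> 2 * (\<mu> + \<gamma>) * \<alpha> + 4 * \<gamma>"
        proof (rule le_larger_root_imp_quadratic_le)
          have "(\<mu> + \<gamma>)\<^sup>2 + (L - \<mu>) * (4 * \<gamma>) = (\<mu> - \<gamma>)\<^sup>2 + 4 * \<gamma> * L"
            by (simp add: power2_eq_square algebra_simps)
          then show "\<alpha> \<le> (\<mu> + \<gamma> + sqrt ((\<mu> + \<gamma>)\<^sup>2 + (L - \<mu>) * (4 * \<gamma>))) / (L - \<mu>)"
            using assms(12) by simp
        qed (use assms(9) pos in auto)
        moreover have "\<alpha>\<^sup>2 * (lam i - \<mu>) \<le> (L - \<mu>) * \<alpha>\<^sup>2"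
          using lam mult_right_mono[of "lam i - \<mu>" "L - \<mu>" "\<alpha>\<^sup>2"]
          by (simp add: mult.commute[of "\<alpha>\<^sup>2"])
        \<comment> \<open>The product
          \<open>(2 + \<alpha>) * (2 * \<gamma> + \<alpha> * \<mu>)\<close> exceeds the quadratic
          bound by exactly this term, so the inequality is strict even at the largest admissible
          step.\<close>
        moreover have "0 < \<alpha> * (\<alpha> * \<mu>)" using pos by simp
        ultimately have "\<alpha>\<^sup>2 * (lam i - \<mu>) < (2 + \<alpha>) * (2 * \<gamma> + \<alpha> * \<mu>)"
          by (simp add: algebra_simps)
        also have "\<dots> = \<gamma> * ((2 + \<alpha>) * (b + 1))"
          using pos by (simp add: b_def field_simps)
        finally have "p * (lam i - \<mu>) < (2 + \<alpha>) * (b + 1)"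
          using pos by (simp add: p_def pos_divide_less_eq mult.commute[of _ \<gamma>])
        then show ?thesis
          by (simp add: t_def algebra_simps)
      qed
      ultimately show "max t (- t) < b * (1 + \<alpha>) + 1" by simp
    qed
    ultimately show ?thesis
      by (rule quadratic_root_norm_less_1)
  qed simp
  moreover have "?E \<in> carrier_mat (2 * n) (2 * n)"
    unfolding nag_gs_iteration_matrix_def
    using nag_gs_inverse(3)[OF assms(2) pos] by (auto simp: nag_gs_N_def)
  \<comment> \<open>In positive dimension the maximum is attained, so the strict bound on each
    eigenvalue passes to the spectral radius.\<close>
  then have "spectral_radius ?E \<in> norm ` spectrum ?E"
    using assms(1) by (intro spectral_radius_mem_max(1)) auto
  ultimately show ?thesis
    unfolding nag_gs_convergent_def spectrum_def by auto
qed

end
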